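(* Let $\mathcal N_1,\mathcal N_2\in\mathfrak N$ be two qubit channels that are quasi-extreme points of $\mathfrak N$. Then side entanglement is not useful for discriminating between $\mathcal N_1$ and $\mathcal N_2$, i.e. $$\sup_{\Psi\in\mathcal P(\mathbb C^2\otimes\mathbb C^2)}\big\|(\mathrm{id}\otimes\mathcal N_1)(\Psi)-(\mathrm{id}\otimes\mathcal N_2)(\Psi)\big\|_1=\sup_{\psi\in\mathcal P(\mathbb C^2)}\big\|\mathcal N_1(\psi)-\mathcal N_2(\psi)\big\|_1 .$$
   Context: $\mathcal D(\mathbb C^2)$ is the set of density operators on $\mathbb C^2$, written $\rho=\frac12(I+\boldsymbol r\cdot\boldsymbol\sigma)$ with $\boldsymbol r\in\mathbb R^3$, $\|\boldsymbol r\|\le 1$, and $\boldsymbol\sigma$ the vector of Pauli operators. A qubit channel is a linear, completely positive, trace-preserving (CPTP) map; it acts on Bloch vectors as $\boldsymbol r\mapsto \boldsymbol N\boldsymbol r+\boldsymbol t$ with $\boldsymbol N$ a real $3\times3$ matrix and $\boldsymbol t\in\mathbb R^3$. $\mathfrak N$ is the set of qubit channels whose matrix $\boldsymbol N$ is diagonal, $\boldsymbol N=\mathrm{diag}(\lambda_1,\lambda_2,\lambda_3)$. The unital channels in $\mathfrak N$ (those with $\boldsymbol t=\boldsymbol 0$) form, in the coordinates $(\lambda_1,\lambda_2,\lambda_3)$, a tetrahedron whose four vertices $(1,1,1),(1,-1,-1),(-1,1,-1),(-1,-1,1)$ are the conjugations by $I$ and by the three Pauli operators. The quasi-extreme points of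 $\mathfrak N$ are the unital channels lying on the edges of this tetrahedron (vertices excluded); the image of the Bloch sphere under such a channel is an ellipsoid having exactly two points in common with the Bloch sphere. They belong to the closure of the extreme points of $\mathfrak N$ but are not true extreme points. $\mathcal P(\mathbb C^2)$ and $\mathcal P(\mathbb C^2\otimes\mathbb C^2)$ denote the sets of pure states (rank-one projectors), $\|\cdot\|_1$ is the trace norm, and $\mathrm{id}$ is the identity map on the operators on the first factor (the reference system). Side entanglement is called useful if the left-hand supremum is strictly greater than the right-hand one, and not useful otherwise. *)

theory Defs
  imports "HOL-Analysis.Analysis"
begin

text \<open>
  Operators on a complex space with orthonormal basis indexed by a finite type \<open>'n\<close> are matrices
  \<open>complex^'n^'n\<close>; thus \<open>complex^2^2\<close> for a qubit. The tensor product of the spaces indexed by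
  \<open>'k\<close> and \<open>'n\<close> is indexed by \<open>'k \<times> 'n\<close>.
\<close>

type_synonym 'n op = "complex^'n^'n"

definition cscale :: "complex \<Rightarrow> 'n::finite op \<Rightarrow> 'n op" where
  "cscale c A = (\<chi> i j. c * A $ i $ j)"

lemma vector_space_cscale: "vector_space (cscale :: complex \<Rightarrow> 'n::finite op \<Rightarrow> 'n op)"
  by unfold_locales (auto simp: cscale_def vec_eq_iff algebra_simps)

definition cadjoint :: "'n::finite op \<Rightarrow> 'n op" where
  "cadjoint A = transpose (map_matrix cnj A)"

definition psd :: "'n::finite op \<Rightarrow> bool" where
  "psd A \<longleftrightarrow> (\<forall>v. (\<Sum>i\<in>UNIV. \<Sum>j\<in>UNIV. cnj (v $ i) * A $ i $ j * v $ j) \<in> \<real>\<^sub>\<ge>\<^sub>0)"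

text \<open>The positive square root of a positive semidefinite operator exists and is unique, so the
  description below is proper for every \<open>B\<close> of the form \<open>cadjoint A ** A\<close>.\<close>

definition psd_sqrt :: "'n::finite op \<Rightarrow> 'n op" where
  "psd_sqrt B = (THE P. psd P \<and> P ** P = B)"

definition trace_norm :: "'n::finite op \<Rightarrow> real" where
  "trace_norm A = Re (trace (psd_sqrt (cadjoint A ** A)))"

definition pure_states :: "'n::finite op set" where
  "pure_states = {P. cadjoint P = P \<and> P ** P = P \<and> rank P = 1}"


subsection \<open>Qubit channels\<close>

text \<open>Positivity of the operator on \<open>\<complex>\<^sup>n \<otimes> \<complex>\<^sup>2\<close> whose block at position \<open>(a, b)\<close>, with \<open>a, b < n\<close>,
  is \<open>X a b\<close>. The dimension \<open>n\<close> of the ancilla is a natural number here because complete positivity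
  quantifies over it.\<close>

definition block_psd :: "nat \<Rightarrow> (nat \<Rightarrow> nat \<Rightarrow> 2 op) \<Rightarrow> bool" where
  "block_psd n X \<longleftrightarrow> (\<forall>v :: nat \<Rightarrow> complex^2.
     (\<Sum>a<n. \<Sum>i\<in>UNIV. \<Sum>b<n. \<Sum>j\<in>UNIV. cnj (v a $ i) * X a b $ i $ j * v b $ j) \<in> \<real>\<^sub>\<ge>\<^sub>0)"

text \<open>On block matrices \<open>id\<^sub>n \<otimes> \<Phi>\<close> is the blockwise application of \<open>\<Phi>\<close>.\<close>

definition completely_positive :: "(2 op \<Rightarrow> 2 op) \<Rightarrow> bool" where
  "completely_positive \<Phi> \<longleftrightarrow> (\<forall>n X. block_psd n X \<longrightarrow> block_psd n (\<lambda>a b. \<Phi> (X a b)))"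

definition trace_preserving :: "(2 op \<Rightarrow> 2 op) \<Rightarrow> bool" where
  "trace_preserving \<Phi> \<longleftrightarrow> (\<forall>A. trace (\<Phi> A) = trace A)"

definition qubit_channel :: "(2 op \<Rightarrow> 2 op) \<Rightarrow> bool" where
  "qubit_channel \<Phi> \<longleftrightarrow>
     Vector_Spaces.linear cscale cscale \<Phi> \<and> completely_positive \<Phi> \<and> trace_preserving \<Phi>"

definition id_tensor :: "('n::finite op \<Rightarrow> 'n op) \<Rightarrow> ('k::finite \<times> 'n) op \<Rightarrow> ('k \<times> 'n) op" where
  "id_tensor \<Phi> X = (\<chi> p q. \<Phi> (\<chi> i j. X $ (fst p, i) $ (fst q, j)) $ snd p $ snd q)"

definition kron :: "'k::finite op \<Rightarrow> 'n::finite op \<Rightarrow> ('k \<times> 'n) op" where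
  "kron A B = (\<chi> p q. A $ fst p $ fst q * B $ snd p $ snd q)"

lemma id_tensor_kron:
  assumes "Vector_Spaces.linear cscale cscale \<Phi>"
  shows "id_tensor \<Phi> (kron A B) = kron A (\<Phi> B)"
proof -
  have "(\<chi> i j. kron A B $ (a, i) $ (b, j)) = cscale (A $ a $ b) B" for a b
    by (simp add: kron_def cscale_def)
  moreover have "\<Phi> (cscale c B) = cscale c (\<Phi> B)" for c
    using assms by (simp add: linear_iff_module_hom module_hom.scale)
  ultimately show ?thesis
    by (simp add: id_tensor_def kron_def cscale_def)
qed


subsection \<open>Bloch representation\<close>

definition sigma_x :: "2 op" where
  "sigma_x = vector [vector [0, 1], vector [1, 0]]"

definition sigma_y :: "2 op" where
  "sigma_y = vector [vector [0, - \<i>], vector [\<i>, 0]]"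

definition sigma_z :: "2 op" where
  "sigma_z = vector [vector [1, 0], vector [0, - 1]]"

definition bloch :: "real^3 \<Rightarrow> 2 op" where
  "bloch r = (1/2) *\<^sub>R (mat 1 + (r $ 1) *\<^sub>R sigma_x + (r $ 2) *\<^sub>R sigma_y + (r $ 3) *\<^sub>R sigma_z)"

definition bloch_action :: "(2 op \<Rightarrow> 2 op) \<Rightarrow> real^3^3 \<Rightarrow> real^3 \<Rightarrow> bool" where
  "bloch_action \<Phi> N t \<longleftrightarrow> (\<forall>r. norm r \<le> 1 \<longrightarrow> \<Phi> (bloch r) = bloch (N *v r + t))"

definition diag :: "real^3 \<Rightarrow> real^3^3" where
  "diag l = (\<chi> i j. if i = j then l $ i else 0)"

definition diagonal_channels :: "(2 op \<Rightarrow> 2 op) set" where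
  "diagonal_channels = {\<Phi>. qubit_channel \<Phi> \<and> (\<exists>l t. bloch_action \<Phi> (diag l) t)}"

definition pauli_vertices :: "(real^3) set" where
  "pauli_vertices = {vector [1, 1, 1], vector [1, - 1, - 1], vector [- 1, 1, - 1], vector [- 1, - 1, 1]}"

definition pauli_tetrahedron :: "(real^3) set" where
  "pauli_tetrahedron = convex hull pauli_vertices"

definition quasi_extreme :: "(2 op \<Rightarrow> 2 op) set" where
  "quasi_extreme = {\<Phi> \<in> diagonal_channels.
     \<exists>l. bloch_action \<Phi> (diag l) 0 \<and>
         (\<exists>e. e edge_of pauli_tetrahedron \<and> l \<in> e) \<and> l \<notin> pauli_vertices}"

end

theory Submission
  imports Defs
begin

text \<open>
  A quasi-extreme channel mixes two Pauli conjugations, so the difference of two of them is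
  \<open>\<rho> \<mapsto> \<Sum>\<^sub>k q\<^sub>k \<sigma>\<^sub>k \<rho> \<sigma>\<^sub>k\<close> with \<open>\<Sum>\<^sub>k q\<^sub>k = 0\<close>, at most two \<open>q\<^sub>k\<close> positive and at most two
  negative. With or without side entanglement its output on a pure state is \<open>\<Sum>\<^sub>k q\<^sub>k |w\<^sub>k\<rangle>\<langle>w\<^sub>k|\<close> for unit
  vectors \<open>w\<^sub>k\<close>, of trace norm at most \<open>\<Sum>\<^sub>k |q\<^sub>k|\<close>. By the sign pattern of \<open>q\<close> some Pauli matrix \<open>\<sigma>\<^sub>j\<close>
  commutes with the \<open>\<sigma>\<^sub>k\<close> of one sign and anticommutes with those of the other; its eigenvectors
  attain the bound without a reference system. The trace norm is handled as
  \<open>max\<^sub>U Re tr (U A)\<close> over the unitaries \<open>U\<close>.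
\<close>

section \<open>Hermitian inner product and positive semidefinite operators\<close>

definition cinner :: "complex^'n::finite \<Rightarrow> complex^'n \<Rightarrow> complex" where
  "cinner u v = (\<Sum>i\<in>UNIV. cnj (u $ i) * v $ i)"

lemma cinner_add_left: "cinner (u + v) w = cinner u w + cinner v w"
  and cinner_add_right: "cinner w (u + v) = cinner w u + cinner w v"
  and cinner_diff_left: "cinner (u - v) w = cinner u w - cinner v w"
  and cinner_diff_right: "cinner w (u - v) = cinner w u - cinner w v"
  and cinner_scale_left: "cinner (c *s u) w = cnj c * cinner u w"
  and cinner_scale_right: "cinner w (c *s u) = c * cinner w u"
  by (simp_all add: cinner_def algebra_simps sum.distrib sum_subtractf sum_distrib_left)

lemmas cinner_simps = cinner_add_left cinner_add_right cinner_diff_left cinner_diff_right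
  cinner_scale_left cinner_scale_right

lemma cnj_cinner: "cnj (cinner u v) = cinner v u"
  by (simp add: cinner_def mult.commute)

lemma cinner_self: "cinner v v = of_real ((norm v)\<^sup>2)"
  by (simp add: cinner_def norm_vec_def L2_set_def sum_nonneg complex_norm_square mult.commute
      flip: of_real_power)

lemma Re_cinner: "Re (cinner u v) = inner u v"
  by (simp add: cinner_def inner_vec_def inner_complex_def)

lemma cinner_self_eq_0: "cinner v v = 0 \<longleftrightarrow> v = 0"
  by (simp add: cinner_self)

lemma cinner_zero [simp]: "cinner 0 v = 0" "cinner v 0 = 0"
  by (simp_all add: cinner_def)

lemma cinner_axis: "cinner (axis i 1) v = v $ i"
  by (simp add: cinner_def axis_def if_distrib if_distribR cong: if_cong)

lemma matrix_vector_mult_axis [simp]: "((A :: 'n::finite op) *v axis j 1) $ i = A $ i $ j"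
  by (simp add: matrix_vector_mult_def axis_def if_distrib if_distribR cong: if_cong)

lemma cadjoint_nth [simp]: "cadjoint A $ i $ j = cnj (A $ j $ i)"
  by (simp add: cadjoint_def transpose_def)

lemma cinner_cadjoint: "cinner (cadjoint A *v u) v = cinner u (A *v v)"
proof -
  have "cinner (cadjoint A *v u) v = (\<Sum>i\<in>UNIV. \<Sum>j\<in>UNIV. cnj (u $ j) * A $ j $ i * v $ i)"
    by (simp add: cinner_def matrix_vector_mult_def sum_distrib_left mult_ac)
  also have "\<dots> = cinner u (A *v v)"
    by (subst sum.swap) (simp add: cinner_def matrix_vector_mult_def sum_distrib_left mult_ac)
  finally show ?thesis .
qed

lemma cadjoint_cadjoint [simp]: "cadjoint (cadjoint A) = A"
  by (simp add: vec_eq_iff)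

lemma cadjoint_mult: "cadjoint (A ** B) = cadjoint B ** cadjoint A"
  by (simp add: vec_eq_iff matrix_matrix_mult_def mult.commute)

lemma psd_iff: "psd A \<longleftrightarrow> (\<forall>v. cinner v (A *v v) \<in> \<real>\<^sub>\<ge>\<^sub>0)"
  by (simp add: psd_def cinner_def matrix_vector_mult_def sum_distrib_left mult.assoc)

text \<open>Polarization: testing the form on \<open>u + v\<close> and on
  \<open>u + \<i> *s v\<close> kills the sum and the difference of the two cross terms, hence each
  of them. The complex scalar is essential, since the form of a real skew matrix vanishes on all
  real vectors.\<close>

lemma matrix_eq_0_if_quadratic_form_0:
  assumes "\<And>v. cinner v (A *v v) = 0"
  shows "A = 0"
proof -
  have *: "cinner u (A *v v) = 0" for u v
  proof -
    have 1: "cinner u (A *v v) + cinner v (A *v u) = 0"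
      using assms[of "u + v"] assms[of u] assms[of v]
      by (simp add: cinner_simps matrix_vector_right_distrib add.commute)
    have 2: "\<i> * cinner u (A *v v) - \<i> * cinner v (A *v u) = 0"
      using assms[of "u + \<i> *s v"] assms[of u] assms[of v]
      by (simp add: cinner_simps matrix_vector_right_distrib vector_scalar_commute)
    show ?thesis
      using 1 2 by (auto simp: complex_eq_iff)
  qed
  have "A *v v = 0" for v
    using *[of "A *v v" v] by (simp add: cinner_self_eq_0)
  then show ?thesis
    by (simp add: matrix_eq)
qed

text \<open>\<open>psd\<close> speaks only about values of the quadratic form. As these are real,
  the form of \<open>cadjoint A - A\<close> vanishes, and polarization applies.\<close>

lemma psd_hermitian:
  assumes "psd A"
  shows "cadjoint A = A"
proof -
  have "cinner v ((cadjoint A - A) *v v) = 0" for v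
  proof -
    have "cinner v (A *v v) \<in> \<real>"
      using assms nonneg_Reals_subset_Reals psd_iff by blast
    then show ?thesis
      using cinner_cadjoint[of "cadjoint A" v v] cnj_cinner[of v "A *v v"]
      by (simp add: matrix_vector_mult_diff_rdistrib cinner_simps complex_is_Real_iff complex_eq_iff)
  qed
  then show ?thesis
    using matrix_eq_0_if_quadratic_form_0 by (metis right_minus_eq)
qed

text \<open>Moving from \<open>x\<close> in the direction \<open>y = A *v x\<close> by a real
  \<open>t\<close>, the form becomes 2 t |y|^2 + t^2 b. It is nonnegative for every
  \<open>t\<close>, so its linear coefficient must vanish.\<close>

lemma psd_kernel:
  assumes "psd A" and x: "cinner x (A *v x) = 0"
  shows "A *v x = 0"
proof -
  let ?y = "A *v x"
  define b where "b = Re (cinner ?y (A *v ?y))"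
  have form: "2 * t * (norm ?y)\<^sup>2 + t\<^sup>2 * b \<ge> 0" for t :: real
  proof -
    let ?v = "x + of_real t *s ?y"
    have 1: "cinner x (A *v ?y) = cinner ?y ?y"
      using cinner_cadjoint[of A x ?y] psd_hermitian[OF assms(1)] by simp
    have "cinner ?v (A *v ?v) = of_real (2 * t * (norm ?y)\<^sup>2) + of_real (t\<^sup>2) * cinner ?y (A *v ?y)"
      using x by (simp add: cinner_simps matrix_vector_right_distrib vector_scalar_commute 1
          cinner_self algebra_simps power2_eq_square)
    moreover have "Re (cinner ?v (A *v ?v)) \<ge> 0"
      using assms(1) by (auto simp: psd_iff complex_nonneg_Reals_iff)
    ultimately show ?thesis
      by (simp add: b_def)
  qed
  have "b \<ge> 0"
    using assms(1) by (auto simp: b_def psd_iff complex_nonneg_Reals_iff)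
  show ?thesis
  proof (rule ccontr)
    assume "?y \<noteq> 0"
    then have pos: "(norm ?y)\<^sup>2 > 0"
      by simp
    \<comment> \<open>With denominator \<open>b + 1\<close>, which is positive even for
      \<open>b = 0\<close>, |t b| is at most |y|^2. The factor 2 |y|^2 + t b then stays positive
      although \<open>t\<close> is negative.\<close>
    define t where "t = - (norm ?y)\<^sup>2 / (b + 1)"
    have "t < 0"
      using pos \<open>b \<ge> 0\<close> by (simp add: t_def divide_neg_pos)
    moreover have "t * (2 * (norm ?y)\<^sup>2 + t * b) \<ge> 0"
      using form[of t] by (simp add: algebra_simps power2_eq_square)
    ultimately have "2 * (norm ?y)\<^sup>2 + t * b \<le> 0"
      by (simp add: zero_le_mult_iff)
    moreover have "- (t * b) \<le> (norm ?y)\<^sup>2"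
      using \<open>b \<ge> 0\<close> pos by (simp add: t_def field_simps)
    ultimately show False
      using pos by linarith
  qed
qed

lemma trace_eq_sum_cinner: "trace A = (\<Sum>i\<in>UNIV. cinner (axis i 1) (A *v axis i 1))"
  by (simp add: trace_def cinner_axis)

text \<open>With \<open>D = P - Q\<close> one has \<open>P D + D Q = P\<^sup>2 - Q\<^sup>2 = 0\<close>, so \<open>tr (D P D) + tr (D Q D) = 0\<close> and
  both (nonnegative) traces vanish; hence \<open>P D = Q D = 0\<close> and \<open>D\<^sup>2 = 0\<close>.\<close>

lemma psd_square_inj:
  assumes P: "psd P" and Q: "psd Q" and PQ: "P ** P = Q ** Q"
  shows "P = Q"
proof -
  define D where "D = P - Q"
  have DP: "P *v v = D *v v + Q *v v" for v
    by (simp add: D_def matrix_vector_mult_diff_rdistrib)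
  have D: "cinner (D *v u) v = cinner u (D *v v)" for u v
    using cinner_cadjoint[of P u v] cinner_cadjoint[of Q u v] psd_hermitian[OF P] psd_hermitian[OF Q]
    by (simp add: D_def matrix_vector_mult_diff_rdistrib cinner_simps)
  have PQv: "P *v (P *v v) = Q *v (Q *v v)" for v
    using PQ by (simp add: matrix_vector_mul_assoc)
  have PD: "P *v (D *v v) = - (D *v (Q *v v))" for v
    using PQv[of v]
    by (simp add: D_def matrix_vector_mult_diff_rdistrib matrix_vector_mult_diff_distrib)
  have tr: "(\<Sum>i\<in>UNIV. cinner (D *v axis i 1) (P *v (D *v axis i 1)))
      = - (\<Sum>i\<in>UNIV. cinner (D *v axis i 1) (Q *v (D *v axis i 1)))" (is "?l = - ?r")
  proof -
    have "?l = - trace (D ** (D ** Q))"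
      by (simp add: D PD trace_eq_sum_cinner matrix_vector_mul_assoc[symmetric] sum_negf[symmetric]
         cinner_simps cinner_diff_right[of _ 0, simplified]
         del: matrix_vector_mul_assoc)
    also have "trace (D ** (D ** Q)) = trace (D ** (Q ** D))"
      by (metis matrix_mul_assoc trace_mul_sym)
    also have "\<dots> = ?r"
      by (simp add: D trace_eq_sum_cinner matrix_vector_mul_assoc[symmetric]
         del: matrix_vector_mul_assoc)
    finally show ?thesis .
  qed
  have nonneg: "Re (cinner v (P *v v)) \<ge> 0" "Re (cinner v (Q *v v)) \<ge> 0"
    "cinner v (P *v v) \<in> \<real>" "cinner v (Q *v v) \<in> \<real>" for v
    using P Q by (auto simp: psd_iff complex_nonneg_Reals_iff complex_is_Real_iff)
  have "(\<Sum>i\<in>UNIV. Re (cinner (D *v axis i 1) (P *v (D *v axis i 1)))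
       + Re (cinner (D *v axis i 1) (Q *v (D *v axis i 1)))) = 0"
    using arg_cong[OF tr, of Re] by (simp add: sum.distrib)
  then have "Re (cinner (D *v axis i 1) (P *v (D *v axis i 1)))
       + Re (cinner (D *v axis i 1) (Q *v (D *v axis i 1))) = 0" for i
    using nonneg by (subst (asm) sum_nonneg_eq_0_iff) (auto intro: add_nonneg_nonneg)
  then have "cinner (D *v axis i 1) (P *v (D *v axis i 1)) = 0"
    "cinner (D *v axis i 1) (Q *v (D *v axis i 1)) = 0" for i
    using nonneg by (simp_all add: complex_eq_iff complex_is_Real_iff add_nonneg_eq_0_iff)
  then have "P *v (D *v axis i 1) = 0" "Q *v (D *v axis i 1) = 0" for i
    using psd_kernel P Q by blast+
  then have "D *v (D *v axis i 1) = 0" for i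
    by (simp add: D_def matrix_vector_mult_diff_rdistrib)
  then have "cinner (D *v axis i 1) (D *v axis i 1) = 0" for i
    by (simp add: D)
  then have "D *v axis i 1 = 0" for i
    by (simp add: cinner_self_eq_0)
  then have "D $ j $ i = 0" for i j
    by (metis matrix_vector_mult_axis zero_index)
  then show ?thesis
    by (simp add: D_def vec_eq_iff)
qed

text \<open>Uniqueness makes the definite description usable: any explicitly given positive root is
  \<open>psd_sqrt B\<close>.\<close>

lemma psd_sqrt_eqI:
  assumes "psd P" and "P ** P = B"
  shows "psd_sqrt B = P"
  unfolding psd_sqrt_def using assms psd_square_inj by (intro the_equality) auto

section \<open>Unitaries and the variational form of the trace norm\<close>

definition unitary :: "'n::finite op \<Rightarrow> bool" where
  "unitary U \<longleftrightarrow> cadjoint U ** U = mat 1"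

lemma unitary_mat_1: "unitary (mat 1)"
proof -
  have "cadjoint (mat 1) = mat 1"
    by (auto simp: vec_eq_iff mat_def)
  then show ?thesis
    by (simp add: unitary_def)
qed

lemma unitary_mult: "unitary U \<Longrightarrow> unitary V \<Longrightarrow> unitary (U ** V)"
  unfolding unitary_def cadjoint_mult by (metis matrix_mul_assoc matrix_mul_lid)

lemma norm_unitary: "unitary U \<Longrightarrow> norm (U *v v) = norm v"
  using cinner_cadjoint[of U "U *v v" v]
  by (simp add: unitary_def matrix_vector_mul_assoc cinner_self of_real_eq_iff flip: of_real_power)

text \<open>Compactness provides a unitary maximizing Re tr (U A). The set is closed as a preimage
  of \<open>mat 1\<close>, and bounded because the columns of a unitary are unit vectors.\<close>

lemma compact_unitary: "compact {U :: 'n::finite op. unitary U}"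
proof -
  have cont: "continuous_on UNIV (\<lambda>U :: 'n op. cadjoint U ** U)"
    unfolding cadjoint_def transpose_def matrix_matrix_mult_def map_matrix_def
    by (intro continuous_intros)
  have "closed {U :: 'n op. unitary U}"
    using continuous_closed_preimage[OF cont closed_UNIV, of "{mat 1}"]
    by (simp add: unitary_def vimage_def)
  moreover have "norm U \<le> real CARD('n) * real CARD('n)" if "unitary U" for U :: "'n op"
  proof -
    have entry: "norm (U $ i $ j) \<le> 1" for i j
    proof -
      have "norm (U $ i $ j) \<le> norm (U *v axis j 1)"
        using Finite_Cartesian_Product.norm_nth_le[of "U *v axis j 1" i] by simp
      then show ?thesis
        by (simp add: norm_unitary that norm_axis_1)
    qed
    have "norm U \<le> (\<Sum>i\<in>UNIV. norm (U $ i))"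
      by (simp add: norm_vec_def L2_set_le_sum)
    also have "\<dots> \<le> (\<Sum>i\<in>UNIV. \<Sum>j\<in>UNIV. norm (U $ i $ j))"
      by (intro sum_mono) (simp add: norm_vec_def L2_set_le_sum)
    also have "\<dots> \<le> (\<Sum>i\<in>(UNIV :: 'n set). \<Sum>j\<in>(UNIV :: 'n set). 1)"
      by (intro sum_mono entry)
    finally show ?thesis by simp
  qed
  ultimately show ?thesis
    unfolding compact_eq_bounded_closed bounded_iff by auto
qed

definition outer :: "complex^'n::finite \<Rightarrow> 'n op" where
  "outer w = (\<chi> i j. w $ i * cnj (w $ j))"

lemma trace_mult_outer: "trace (A ** outer w) = cinner w (A *v w)"
  by (simp add: trace_def outer_def cinner_def matrix_matrix_mult_def matrix_vector_mult_def
      sum_distrib_left mult_ac)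

lemma outer_mult_vector: "outer w *v v = cinner w v *s w"
  by (simp add: outer_def cinner_def matrix_vector_mult_def vec_eq_iff sum_distrib_left mult_ac)

lemma norm_vector_scalar: "norm (c *s (v :: complex^'n::finite)) = norm c * norm v"
  by (simp add: norm_vec_def norm_mult L2_set_right_distrib)

lemma trace_mult_sub: "trace ((A - B) ** C) = trace (A ** C) - trace ((B :: 'n::finite op) ** C)"
  by (simp add: trace_def matrix_matrix_mult_def left_diff_distrib sum_subtractf)

text \<open>The operator \<open>?V\<close> multiplies \<open>w\<close> by \<open>c\<close> and fixes
  the orthogonal complement. It changes |v|^2 only by the term (1 - |c|^2) |<w,v>|^2, which is
  0.\<close>

lemma unitary_phase:
  fixes w :: "complex^'n::finite"
  assumes w: "norm w = 1" and c: "norm c = 1"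
  shows "unitary (mat 1 - cscale (1 - c) (outer w))" (is "unitary ?V")
proof -
  have V: "?V *v v = v - ((1 - c) * cinner w v) *s w" for v
  proof -
    have "cscale (1 - c) (outer w) *v v = (1 - c) *s (outer w *v v)"
      by (simp only: cscale_def matrix_vector_mult_def vec_eq_iff sum_distrib_left mult.assoc
          vec_lambda_beta vector_smult_component) simp
    then show ?thesis
      by (simp add: matrix_vector_mult_diff_rdistrib outer_mult_vector vector_smult_assoc)
  qed
  have ww: "cinner w w = 1"
    using w by (simp add: cinner_self)
  have cc: "c * cnj c = 1"
    using c by (simp add: complex_norm_square[symmetric])
  have "cinner v ((cadjoint ?V ** ?V - mat 1) *v v) = 0" for v
  proof -
    have "cinner v ((cadjoint ?V ** ?V) *v v) = cinner (?V *v v) (?V *v v)"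
      by (metis cinner_cadjoint cadjoint_cadjoint matrix_vector_mul_assoc)
    also have "\<dots> = cinner v v - (1 - c * cnj c) * cinner w v * cinner v w"
      unfolding V by (simp add: cinner_simps ww cnj_cinner algebra_simps)
    finally show ?thesis
      by (simp add: cc matrix_vector_mult_diff_rdistrib cinner_simps)
  qed
  then show ?thesis
    unfolding unitary_def using matrix_eq_0_if_quadratic_form_0 by (metis right_minus_eq)
qed

text \<open>Testing the maximality of \<open>tr P\<close> against the unitary that multiplies \<open>v\<close> by a phase \<open>c\<close> and fixes
  its orthogonal complement gives \<open>Re z \<ge> Re (c z)\<close> for \<open>z = \<langle>v, P v\<rangle>\<close>; taking \<open>c z = |z|\<close> yields
  \<open>z \<ge> 0\<close>.\<close>

lemma psd_if_trace_maximal: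
  fixes P :: "'n::finite op"
  assumes max: "\<And>V. unitary V \<Longrightarrow> Re (trace (V ** P)) \<le> Re (trace P)"
  shows "psd P"
proof -
  have unit: "cinner w (P *v w) \<in> \<real>\<^sub>\<ge>\<^sub>0" if w: "norm w = 1" for w
  proof (cases "cinner w (P *v w) = 0")
    case False
    define z where "z = cinner w (P *v w)"
    define c where "c = cnj z / norm z"
    have nz: "norm z \<noteq> 0"
      using False by (simp add: z_def)
    then have c: "norm c = 1" and cz: "c * z = norm z"
      by (simp_all add: c_def norm_divide field_simps complex_norm_square[symmetric] power2_eq_square)
    have "trace (cscale (1 - c) (outer w) ** P) = (1 - c) * trace (outer w ** P)"
      by (simp add: trace_def cscale_def matrix_matrix_mult_def sum_distrib_left mult.assoc)
    also have "trace (outer w ** P) = z"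
      by (metis trace_mul_sym trace_mult_outer z_def)
    finally have "Re ((1 - c) * z) \<ge> 0"
      using max[OF unitary_phase[OF w c]] by (simp add: trace_mult_sub)
    then have "Re z \<ge> norm z"
      using cz by (simp add: left_diff_distrib)
    then have "Re z = norm z"
      using complex_Re_le_cmod[of z] by linarith
    then show ?thesis
      using cmod_power2[of z] by (simp add: complex_nonneg_Reals_iff z_def[symmetric])
  qed simp
  have "cinner v (P *v v) \<in> \<real>\<^sub>\<ge>\<^sub>0" for v
  proof (cases "v = 0")
    case False
    define w where "w = complex_of_real (1 / norm v) *s v"
    have "norm w = 1"
      using False by (simp add: w_def norm_vector_scalar norm_divide)
    have "v = complex_of_real (norm v) *s w"
      using False by (simp add: w_def)
    then have "cinner v (P *v v) = of_real ((norm v)\<^sup>2) * cinner w (P *v w)"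
      by (metis cinner_scale_left cinner_scale_right complex_cnj_complex_of_real mult.assoc
          of_real_mult power2_eq_square vector_scalar_commute)
    then show ?thesis
      using unit[OF \<open>norm w = 1\<close>] by (simp add: nonneg_Reals_mult_I)
  qed simp
  then show ?thesis
    by (simp add: psd_iff)
qed

text \<open>This yields a polar decomposition without spectral theory. If \<open>U\<close> maximizes
  Re tr (U A), then \<open>U ** A\<close> is maximal against every further unitary \<open>V\<close>,
  hence positive. Its square is \<open>cadjoint A ** A\<close>, so it is the root in the definition
  of \<open>trace_norm\<close>.\<close>

lemma trace_norm_maximal:
  fixes A :: "'n::finite op"
  obtains U where "unitary U" and "trace_norm A = Re (trace (U ** A))"
    and "\<And>V. unitary V \<Longrightarrow> Re (trace (V ** A)) \<le> trace_norm A"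
proof -
  have "continuous_on {U. unitary U} (\<lambda>U. Re (trace (U ** A)))"
    unfolding trace_def matrix_matrix_mult_def by (intro continuous_intros)
  moreover have "mat 1 \<in> {U :: 'n op. unitary U}"
    by (simp add: unitary_mat_1)
  ultimately obtain U where U: "unitary U"
    and max: "\<And>V. unitary V \<Longrightarrow> Re (trace (V ** A)) \<le> Re (trace (U ** A))"
    using continuous_attains_sup[OF compact_unitary] by (metis empty_iff mem_Collect_eq)
  have "psd (U ** A)"
  proof (rule psd_if_trace_maximal)
    show "Re (trace (V ** (U ** A))) \<le> Re (trace (U ** A))" if "unitary V" for V
      using max[OF unitary_mult[OF that U]] by (simp add: matrix_mul_assoc)
  qed
  moreover have "(U ** A) ** (U ** A) = cadjoint A ** A"
  proof -
    have "(U ** A) ** (U ** A) = cadjoint (U ** A) ** (U ** A)"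
      using psd_hermitian[OF calculation] by simp
    also have "\<dots> = cadjoint A ** (cadjoint U ** U) ** A"
      by (simp only: cadjoint_mult matrix_mul_assoc)
    finally show ?thesis
      using U by (simp add: unitary_def)
  qed
  ultimately have "trace_norm A = Re (trace (U ** A))"
    by (simp add: trace_norm_def psd_sqrt_eqI)
  then show ?thesis
    using that U max by metis
qed

lemma trace_norm_ge: "unitary V \<Longrightarrow> Re (trace (V ** A)) \<le> trace_norm A"
  by (rule trace_norm_maximal[of A]) blast

section \<open>Pure states as projectors onto unit vectors\<close>

lemma pure_state_outer:
  assumes "P \<in> pure_states"
  obtains w where "norm w = 1" and "P = outer w"
proof -
  have herm: "cnj (P $ j $ i) = P $ i $ j" for i j
  proof -
    have "cadjoint P = P"
      using assms by (simp add: pure_states_def)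
    then show ?thesis
      by (metis cadjoint_nth)
  qed
  \<comment> \<open>Rank 1 says that the row space is spanned by a single vector
    \<open>b\<close>.\<close>
  obtain B where B: "B \<subseteq> rows P" "rows P \<subseteq> vec.span B" "card B = vec.dim (rows P)"
    and B': "vec.independent B"
    using vec.basis_exists[of "rows P"] by metis
  have "rank P = 1"
    using assms by (simp add: pure_states_def)
  then obtain b where b: "B = {b}"
    using B(3) by (metis row_rank_def_gen card_1_singletonE)
  have "P $ i \<in> rows P" for i
    by (auto simp: rows_def row_def vec_lambda_eta)
  then have "\<exists>c. P $ i = c *s b" for i
    using B(2) unfolding b vec.span_singleton by blast
  then obtain c where c: "P $ i = c i *s b" for i
    by metis
  have "P \<noteq> 0"
  proof
    assume "P = 0"
    then have "rows P \<subseteq> {0}"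
      by (auto simp: rows_def row_def vec_eq_iff)
    then have "b = 0"
      using B(1) b by blast
    moreover have "vec.independent B"
      using B' .
    ultimately show False
      using b vec.dependent_zero by blast
  qed
  then have "b \<noteq> 0"
    using c by (auto simp: vec_eq_iff)
  then obtain k where k: "b $ k \<noteq> 0"
    by (auto simp: vec_eq_iff)
  \<comment> \<open>The rows of \<open>outer w\<close> are multiples of the conjugate of
    \<open>w\<close>, so the candidate direction is the conjugate of \<open>b\<close>. Hermiticity
    at the nonzero entry \<open>b $ k\<close> ties the row coefficients to \<open>u\<close>;
    idempotence then forces d |u|^2 = 1.\<close>
  define u where "u = (\<chi> i. cnj (b $ i))"
  define d where "d = cnj (c k) / b $ k"
  have "c i = d * u $ i" for i
    using herm[of k i] k by (simp add: c d_def u_def eq_divide_eq)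
  then have P: "P $ i $ j = d * (u $ i * cnj (u $ j))" for i j
    by (simp add: c u_def)
  have "u \<noteq> 0"
    using k by (auto simp: u_def vec_eq_iff)
  obtain i j where ij: "P $ i $ j \<noteq> 0"
    using \<open>P \<noteq> 0\<close> by (auto simp: vec_eq_iff)
  have "P $ i $ j = (\<Sum>m\<in>UNIV. P $ i $ m * P $ m $ j)"
  proof -
    have "P ** P = P"
      using assms by (simp add: pure_states_def)
    then have "P $ i $ j = (P ** P) $ i $ j"
      by simp
    then show ?thesis
      by (simp only: matrix_matrix_mult_def vec_lambda_beta)
  qed
  also have "\<dots> = P $ i $ j * (d * cinner u u)"
    by (simp add: P cinner_def sum_distrib_left mult_ac)
  finally have du: "d * of_real ((norm u)\<^sup>2) = 1"
    using ij by (simp add: cinner_self)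
  define w where "w = of_real (1 / norm u) *s u"
  have "norm w = 1"
    using \<open>u \<noteq> 0\<close> by (simp add: w_def norm_vector_scalar norm_divide)
  moreover have "P = outer w"
  proof -
    have "d = of_real (1 / norm u) * of_real (1 / norm u)"
      using du \<open>u \<noteq> 0\<close> by (simp add: eq_divide_eq power2_eq_square mult.assoc)
    then show ?thesis
      by (simp add: vec_eq_iff P outer_def w_def)
  qed
  ultimately show ?thesis
    using that by blast
qed

lemma outer_pure_state:
  assumes w: "norm w = 1"
  shows "outer w \<in> pure_states"
proof -
  have "outer w ** outer w = outer w"
  proof -
    have "(outer w ** outer w) $ i $ j = cinner w w * outer w $ i $ j" for i j
      by (simp add: outer_def matrix_matrix_mult_def cinner_def sum_distrib_left sum_distrib_right mult_ac)
    then show ?thesis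
      using w by (simp add: vec_eq_iff cinner_self)
  qed
  moreover have "cadjoint (outer w) = outer w"
    by (simp add: vec_eq_iff outer_def mult.commute)
  moreover have "rank (outer w) = 1"
  proof -
    obtain k where k: "w $ k \<noteq> 0"
      using w by (metis norm_zero vec_eq_iff zero_index zero_neq_one)
    \<comment> \<open>Row \<open>i\<close> is \<open>w $ i\<close> times the conjugate of
      \<open>w\<close>, so a row with nonzero coefficient spans the row space.\<close>
    let ?b = "outer w $ k"
    have row: "outer w $ i = (w $ i / w $ k) *s ?b" for i
      using k by (simp add: outer_def vec_eq_iff)
    have rows: "rows (outer w) = range (\<lambda>i. outer w $ i)"
      by (auto simp: rows_def row_def vec_lambda_eta)
    have "vec.dim (rows (outer w)) = 1"
    proof (rule vec.dim_unique)
      show "{?b} \<subseteq> rows (outer w)"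
        by (auto simp: rows)
      show "rows (outer w) \<subseteq> vec.span {?b}"
        unfolding rows vec.span_singleton using row by blast
      have "?b $ k \<noteq> 0"
        using k by (simp add: outer_def)
      then have "?b \<noteq> 0"
        by (metis zero_index)
      then show "vec.independent {?b}"
        by simp
    qed simp
    then show ?thesis
      by (simp add: row_rank_def_gen)
  qed
  ultimately show ?thesis
    by (simp add: pure_states_def)
qed

section \<open>Trace norms of signed mixtures and of tensor products\<close>

lemma matrix_mult_sum_right: "(A :: 'n::finite op) ** (\<Sum>k\<in>K. B k) = (\<Sum>k\<in>K. A ** B k)"
  by (induction K rule: infinite_finite_induct)
    (simp_all add: matrix_add_ldistrib matrix_matrix_mult_def vec_eq_iff sum.distrib distrib_left)

lemma trace_sum: "trace (\<Sum>k\<in>K. (B :: 'k \<Rightarrow> 'n::finite op) k) = (\<Sum>k\<in>K. trace (B k))"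
  by (induction K rule: infinite_finite_induct) (simp_all add: trace_def sum.distrib)

lemma matrix_mult_scaleR_right: "(A :: 'n::finite op) ** (r *\<^sub>R B) = r *\<^sub>R (A ** B)"
  by (simp add: matrix_matrix_mult_def vec_eq_iff scaleR_sum_right)

lemma trace_scaleR: "trace (r *\<^sub>R (B :: 'n::finite op)) = r *\<^sub>R trace B"
  by (simp add: trace_def scaleR_sum_right)

text \<open>At an optimal unitary \<open>U\<close> the summand \<open>k\<close> contributes q_k Re
  <w_k, U w_k>, which is at most |q_k| by Cauchy-Schwarz. The vectors need not be
  orthogonal.\<close>

lemma trace_norm_sum_outer_le:
  assumes "\<And>k. k \<in> K \<Longrightarrow> norm (w k) = 1"
  shows "trace_norm (\<Sum>k\<in>K. q k *\<^sub>R outer (w k)) \<le> (\<Sum>k\<in>K. \<bar>q k\<bar>)"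
proof -
  obtain U where U: "unitary U" and
    eq: "trace_norm (\<Sum>k\<in>K. q k *\<^sub>R outer (w k)) = Re (trace (U ** (\<Sum>k\<in>K. q k *\<^sub>R outer (w k))))"
    using trace_norm_maximal by blast
  note eq
  also have "Re (trace (U ** (\<Sum>k\<in>K. q k *\<^sub>R outer (w k)))) = (\<Sum>k\<in>K. q k * inner (w k) (U *v w k))"
    by (simp add: matrix_mult_sum_right trace_sum matrix_mult_scaleR_right trace_scaleR
        trace_mult_outer Re_cinner)
  also have "\<dots> \<le> (\<Sum>k\<in>K. \<bar>q k\<bar>)"
  proof (rule sum_mono)
    fix k assume "k \<in> K"
    then have "\<bar>inner (w k) (U *v w k)\<bar> \<le> 1"
      using Cauchy_Schwarz_ineq2[of "w k" "U *v w k"] assms by (simp add: norm_unitary[OF U])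
    then have "\<bar>q k * inner (w k) (U *v w k)\<bar> \<le> \<bar>q k\<bar>"
      by (simp add: abs_mult mult_left_le)
    then show "q k * inner (w k) (U *v w k) \<le> \<bar>q k\<bar>"
      by linarith
  qed
  finally show ?thesis .
qed

lemma sum_UNIV_prod:
  "(\<Sum>p\<in>UNIV. f p) = (\<Sum>a\<in>(UNIV :: 'a::finite set). \<Sum>b\<in>(UNIV :: 'b::finite set). f (a, b))"
  by (simp add: sum.cartesian_product)

lemma kron_mult: "kron A B ** kron C D = kron (A ** C) (B ** D)"
  unfolding vec_eq_iff kron_def matrix_matrix_mult_def
  by (simp add: sum_UNIV_prod sum_product mult.assoc mult.left_commute)

lemma trace_kron: "trace (kron A B) = trace A * trace B"
  by (simp add: kron_def trace_def sum_product sum_UNIV_prod)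

lemma kron_mat_1: "kron (mat 1) (mat 1) = mat 1"
  by (auto simp: kron_def mat_def vec_eq_iff)

lemma cadjoint_kron: "cadjoint (kron A B) = kron (cadjoint A) (cadjoint B)"
  by (simp add: kron_def vec_eq_iff)

lemma unitary_kron: "unitary A \<Longrightarrow> unitary B \<Longrightarrow> unitary (kron A B)"
  by (simp add: unitary_def cadjoint_kron kron_mult kron_mat_1)

text \<open>If \<open>U\<close> is optimal for \<open>X\<close>, then \<open>kron (mat 1) U\<close>
  already reaches the same value on the tensor product. Thus a product input does at least as well
  as the local one.\<close>

lemma trace_norm_kron_outer_ge:
  assumes "norm v = 1"
  shows "trace_norm X \<le> trace_norm (kron (outer v) X)"
proof -
  obtain U where U: "unitary U" "trace_norm X = Re (trace (U ** X))"
    using trace_norm_maximal by blast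
  have "trace (kron (mat 1) U ** kron (outer v) X) = trace (outer v) * trace (U ** X)"
    by (simp add: kron_mult trace_kron)
  also have "trace (outer v) = 1"
    using trace_mult_outer[of "mat 1" v] assms by (simp add: cinner_self)
  finally have "trace_norm X = Re (trace (kron (mat 1) U ** kron (outer v) X))"
    using U by simp
  also have "\<dots> \<le> trace_norm (kron (outer v) X)"
    by (intro trace_norm_ge unitary_kron unitary_mat_1 U(1))
  finally show ?thesis .
qed

lemma kron_outer: "kron (outer v) (outer w) = outer (\<chi> p. v $ fst p * w $ snd p)"
  by (simp add: kron_def outer_def vec_eq_iff mult_ac)

lemma norm_tensor_vector:
  fixes v :: "complex^'k::finite" and w :: "complex^'n::finite"
  assumes "norm v = 1" "norm w = 1"
  shows "norm (\<chi> p. v $ fst p * w $ snd p) = 1" (is "norm ?x = 1")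
proof -
  \<comment> \<open>The squared norm is the trace of the projector, and that trace is multiplicative
    under \<open>kron\<close>.\<close>
  have tr: "trace (outer ?x) = trace (outer v) * trace (outer w)"
    by (simp add: kron_outer[symmetric] trace_kron)
  moreover have "trace (outer y) = of_real ((norm y)\<^sup>2)" for y :: "complex^'m::finite"
    using trace_mult_outer[of "mat 1" y] by (simp add: cinner_self)
  ultimately have "complex_of_real ((norm ?x)\<^sup>2) = 1"
    using assms tr by (metis mult_1 of_real_1 power_one)
  then have "(norm ?x)\<^sup>2 = 1"
    by (simp only: of_real_eq_1_iff)
  then show ?thesis
    by (simp add: power2_eq_1_iff) (smt (verit) norm_ge_zero)
qed

lemma conjugate_nth:
  "((S :: 'n::finite op) ** A ** cadjoint S) $ i $ j
    = (\<Sum>m\<in>UNIV. \<Sum>n\<in>UNIV. S $ i $ m * A $ m $ n * cnj (S $ j $ n))"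
  by (subst sum.swap) (simp only: matrix_matrix_mult_def vec_lambda_beta sum_distrib_right cadjoint_nth)

lemma kron_mat_1_vector:
  fixes S :: "'n::finite op" and w :: "complex^('k::finite \<times> 'n)"
  shows "(kron (mat 1) S *v w) $ p = (\<Sum>m\<in>UNIV. S $ snd p $ m * w $ (fst p, m))"
proof -
  have "(kron (mat 1) S *v w) $ p
      = (\<Sum>a\<in>UNIV. if fst p = a then \<Sum>m\<in>UNIV. S $ snd p $ m * w $ (a, m) else 0)"
    unfolding matrix_vector_mult_def kron_def mat_def vec_lambda_beta sum_UNIV_prod
    by (intro sum.cong) auto
  then show ?thesis
    by simp
qed

text \<open>Conjugation by \<open>S\<close> on the second factor acts on state vectors as the
  identity tensor \<open>S\<close>. This keeps each Pauli term of an extended channel of the form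
  \<open>outer\<close>.\<close>

lemma id_tensor_conjugate_outer:
  fixes w :: "complex^('k::finite \<times> 'n::finite)"
  shows "id_tensor (\<lambda>A. S ** A ** cadjoint S) (outer w) = outer (kron (mat 1) S *v w)"
proof -
  have "id_tensor (\<lambda>A. S ** A ** cadjoint S) (outer w) $ p $ q
     
          = (\<Sum>m\<in>UNIV. \<Sum>n\<in>UNIV. (S $ snd p $ m * w $ (fst p, m)) * cnj (S $ snd q $ n * w $ (fst q, n)))" for p q
    unfolding id_tensor_def vec_lambda_beta conjugate_nth outer_def
    by (intro sum.cong refl) simp
  then show ?thesis
    unfolding vec_eq_iff by (simp only: outer_def vec_lambda_beta kron_mat_1_vector cnj_sum sum_product) simp
qed

section \<open>Unital diagonal channels as Pauli mixtures\<close>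

definition pauli :: "nat \<Rightarrow> 2 op" where
  "pauli k = (if k = 0 then mat 1 else if k = 1 then sigma_x else if k
      = 2 then sigma_y else sigma_z)"

lemma pauli_nth:
  "pauli k $ 1 $ 1 = (if k = 0 then 1 else if k = 1 then 0 else if k = 2 then 0 else 1)"
  "pauli k $ 1 $ 2 = (if k = 0 then 0 else if k = 1 then 1 else if k = 2 then - \<i> else 0)"
  "pauli k $ 2 $ 1 = (if k = 0 then 0 else if k = 1 then 1 else if k = 2 then \<i> else 0)"
  "pauli k $ 2 $ 2 = (if k = 0 then 1 else if k = 1 then 0 else if k = 2 then 0 else - 1)"
  by (simp_all add: pauli_def sigma_x_def sigma_y_def sigma_z_def mat_def)

lemma op2_eq_iff:
  "(A :: 2 op) = B \<longleftrightarrow> A $ 1 $ 1 = B $ 1 $ 1 \<and> A $ 1 $ 2 = B $ 1 $ 2 \<and> A $ 2 $ 1 = B $ 2 $ 1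
      \<and> A $ 2 $ 2 = B $ 2 $ 2"
  by (auto simp: vec_eq_iff forall_2)

lemma unitary_pauli: "unitary (pauli k)"
  by (simp add: unitary_def op2_eq_iff matrix_matrix_mult_def sum_2 pauli_nth mat_def)

text \<open>The barycentric coordinates of \<open>l\<close> with respect to the four vertices. They
  solve the system in which the weights sum to 1 and l_1 = p_0 + p_1 - p_2 - p_3, with l_2 and l_3
  analogous.\<close>

definition pauli_weight :: "real^3 \<Rightarrow> nat \<Rightarrow> real" where
  "pauli_weight l k = (if k = 0 then 1 + l $ 1 + l $ 2 + l $ 3
     else if k = 1 then 1 + l $ 1 - l $ 2 - l $ 3
     else if k = 2 then 1 - l $ 1 + l $ 2 - l $ 3
     else 1 - l $ 1 - l $ 2 + l $ 3) / 4"

lemma sum_lessThan_4: "(\<Sum>k<4. f k) = f 0 + f 1 + f 2 + f (3 :: nat)"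
  by (simp add: eval_nat_numeral)

lemma scaleR_eq_cscale: "r *\<^sub>R A = cscale (of_real r) (A :: 'n::finite op)"
  by (simp only: vec_eq_iff cscale_def vec_lambda_beta vector_scaleR_component)
    (simp only: scaleR_conv_of_real simp_thms)

lemma cscale_0: "cscale 0 A = 0"
  by (simp add: vec_eq_iff cscale_def)

lemma cscale_cscale: "cscale a (cscale b A) = cscale (a * b) A"
  by (simp add: vec_eq_iff cscale_def)

lemma bloch_axis: "bloch (axis j 1) = (1/2) *\<^sub>R (pauli 0 + pauli (if j = 1 then 1 else if j
    = 2 then 2 else 3))"
  using exhaust_3[of j] by (auto simp: bloch_def axis_def pauli_def scaleR_add_right)

text \<open>\<open>bloch_action\<close> covers only the unit ball. The center gives the identity
  matrix, and the unit vector on each axis then gives one Pauli matrix by linearity.\<close>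

lemma channel_on_pauli:
  assumes lin: "Vector_Spaces.linear cscale cscale \<Phi>" and act: "bloch_action \<Phi> (diag l) 0"
  shows "\<Phi> (pauli 0) = pauli 0" and "\<Phi> (pauli 1) = cscale (l $ 1) (pauli 1)"
    and "\<Phi> (pauli 2) = cscale (l $ 2) (pauli 2)" and "\<Phi> (pauli 3) = cscale (l $ 3) (pauli 3)"
proof -
  have add: "\<Phi> (A + B) = \<Phi> A + \<Phi> B" and scale: "\<Phi> (cscale c A) = cscale c (\<Phi> A)" for A B c
    using lin by (simp_all add: linear_iff_module_hom module_hom.scale module_hom.add)
  have half: "(1/2) *\<^sub>R A = cscale (1/2) A" for A :: "2 op"
    by (simp add: scaleR_eq_cscale)
  have cancel: "A = B" if "cscale (1/2) A = cscale (1/2) B" for A B :: "2 op"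
    using that by (simp add: cscale_def vec_eq_iff)
  have "bloch 0 = cscale (1/2) (pauli 0)"
    by (simp add: bloch_def pauli_def half[symmetric])
  moreover have "\<Phi> (bloch 0) = bloch 0"
    using act unfolding bloch_action_def by (metis add.right_neutral matrix_vector_mult_0_right norm_zero zero_le_one)
  ultimately have "cscale (1/2) (\<Phi> (pauli 0)) = cscale (1/2) (pauli 0)"
    by (simp add: scale[symmetric])
  then show 0: "\<Phi> (pauli 0) = pauli 0"
    by (rule cancel)
  have diag: "diag l *v axis j 1 + 0 = (l $ j) *\<^sub>R axis j 1" for j
    unfolding matrix_vector_mult_basis by (auto simp: vec_eq_iff column_def diag_def axis_def)
  have bl: "\<Phi> (bloch (axis j 1)) = bloch ((l $ j) *\<^sub>R axis j 1)" for j
    using act unfolding bloch_action_def diag[symmetric] by (simp add: norm_axis_1)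
  have *: "\<Phi> (pauli k) = cscale (l $ j) (pauli k)" if k: "k = (if j = 1 then 1 else if j
      = 2 then 2 else 3)" for j k
  proof -
    have "cscale (1/2) (pauli 0 + \<Phi> (pauli k)) = \<Phi> (bloch (axis j 1))"
      by (simp add: bloch_axis half scale add 0 k)
    also have "\<dots> = cscale (1/2) (pauli 0 + cscale (l $ j) (pauli k))"
      unfolding bl using exhaust_3[of j]
      by (auto simp: k bloch_def axis_def pauli_def half scaleR_eq_cscale cscale_0)
    finally show ?thesis
      using cancel by (metis add_left_cancel)
  qed
  show "\<Phi> (pauli 1) = cscale (l $ 1) (pauli 1)" "\<Phi> (pauli 2) = cscale (l $ 2) (pauli 2)"
    "\<Phi> (pauli 3) = cscale (l $ 3) (pauli 3)"
    by (rule *; simp)+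
qed

text \<open>Conjugation by \<open>pauli k\<close> multiplies each Pauli matrix by 1 or -1. Averaged
  with the weights, these signs give the factor \<open>l $ j\<close> by which the channel scales the
  Pauli matrix with index \<open>j\<close>.\<close>

lemma channel_eq_pauli_mixture:
  assumes lin: "Vector_Spaces.linear cscale cscale \<Phi>" and act: "bloch_action \<Phi> (diag l) 0"
  shows "\<Phi> A = (\<Sum>k<4. pauli_weight l k *\<^sub>R (pauli k ** A ** cadjoint (pauli k)))"
proof -
  have add: "\<Phi> (A + B) = \<Phi> A + \<Phi> B" and scale: "\<Phi> (cscale c A) = cscale c (\<Phi> A)" for A B c
    using lin by (simp_all add: linear_iff_module_hom module_hom.scale module_hom.add)
  \<comment> \<open>The coefficients in the Pauli basis are tr (pauli k ** A) / 2.\<close>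
  define a0 a1 a2 a3 where a: "a0 = (A $ 1 $ 1 + A $ 2 $ 2) / 2" "a1 = (A $ 1 $ 2 + A $ 2 $ 1) / 2"
    "a2 = \<i> * (A $ 1 $ 2 - A $ 2 $ 1) / 2" "a3 = (A $ 1 $ 1 - A $ 2 $ 2) / 2"
  have A: "A
      = cscale a0 (pauli 0) + cscale a1 (pauli 1) + cscale a2 (pauli 2) + cscale a3 (pauli 3)"
    by (simp add: op2_eq_iff cscale_def pauli_nth a field_simps)
  have "\<Phi> A = cscale a0 (pauli 0) + cscale (a1 * l $ 1) (pauli 1) + cscale (a2 * l $ 2) (pauli 2)
      + cscale (a3 * l $ 3) (pauli 3)"
    by (subst A) (simp add: add scale channel_on_pauli[OF assms, simplified] cscale_cscale)
  also have "\<dots> = (\<Sum>k<4. pauli_weight l k *\<^sub>R (pauli k ** A ** cadjoint (pauli k)))"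
    unfolding sum_lessThan_4
    by (simp add: scaleR_eq_cscale op2_eq_iff cscale_def a pauli_nth matrix_matrix_mult_def sum_2 pauli_weight_def
        field_simps)
  finally show ?thesis .
qed

section \<open>Edges of the Pauli tetrahedron\<close>

lemma pauli_vertices_affine_independent: "\<not> affine_dependent pauli_vertices"
proof
  let ?a = "vector [1, 1, 1] :: real^3" and ?b = "vector [1, - 1, - 1] :: real^3"
  let ?c = "vector [- 1, 1, - 1] :: real^3" and ?d = "vector [- 1, - 1, 1] :: real^3"
  have dist: "?a \<noteq> ?b" "?a \<noteq> ?c" "?a \<noteq> ?d" "?b \<noteq> ?c" "?b \<noteq> ?d" "?c \<noteq> ?d"
    by (simp_all add: vec_eq_iff forall_3)
  assume "affine_dependent pauli_vertices"
  then obtain U where 1: "sum U pauli_vertices = 0" and 2: "\<exists>v\<in>pauli_vertices. U v \<noteq> 0"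
    and 3: "(\<Sum>v\<in>pauli_vertices. U v *\<^sub>R v) = 0"
    by (auto simp: affine_dependent_explicit_finite pauli_vertices_def)
  have sums: "U ?a + U ?b + U ?c + U ?d = 0"
    "U ?a *\<^sub>R ?a + U ?b *\<^sub>R ?b + U ?c *\<^sub>R ?c + U ?d *\<^sub>R ?d = 0"
    using 1 3 dist by (simp_all add: pauli_vertices_def add.assoc)
  \<comment> \<open>The three coordinates and the vanishing total form a 4 by 4 system whose sign
    matrix is invertible.\<close>
  have "U ?a + U ?b - U ?c - U ?d = 0" "U ?a - U ?b + U ?c - U ?d
      = 0" "U ?a - U ?b - U ?c + U ?d = 0"
    using arg_cong[OF sums(2), of "\<lambda>x. x $ 1"] arg_cong[OF sums(2), of "\<lambda>x. x $ 2"]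
      arg_cong[OF sums(2), of "\<lambda>x. x $ 3"] by simp_all
  then have "U ?a = 0" "U ?b = 0" "U ?c = 0" "U ?d = 0"
    using sums(1) by linarith+
  then show False
    using 2 by (simp add: pauli_vertices_def)
qed

lemma pauli_weight_segment:
  "pauli_weight ((1 - u) *\<^sub>R v + u *\<^sub>R w) k = (1 - u) * pauli_weight v k + u * pauli_weight w k"
  by (simp add: pauli_weight_def field_simps)

lemma pauli_weight_vertex:
  assumes "v \<in> pauli_vertices"
  obtains a where "a < 4" and "\<And>k. k < 4 \<Longrightarrow> pauli_weight v k = (if k = a then 1 else 0)"
proof -
  have less_4: "k < 4 \<longleftrightarrow> k = 0 \<or> k = 1 \<or> k = 2 \<or> k = 3" for k :: nat
    by auto
  consider "v = vector [1, 1, 1]" | "v = vector [1, - 1, - 1]" | "v = vector [- 1, 1, - 1]"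
    | "v = vector [- 1, - 1, 1]"
    using assms by (auto simp: pauli_vertices_def)
  then show ?thesis
  proof cases
    case 1
    then show ?thesis
      by (intro that[of 0]) (auto simp: less_4 pauli_weight_def)
  next
    case 2
    then show ?thesis
      by (intro that[of 1]) (auto simp: less_4 pauli_weight_def)
  next
    case 3
    then show ?thesis
      by (intro that[of 2]) (auto simp: less_4 pauli_weight_def)
  next
    case 4
    then show ?thesis
      by (intro that[of 3]) (auto simp: less_4 pauli_weight_def)
  qed
qed

text \<open>Faces of a simplex are hulls of vertex subsets, and dimension 1 leaves two vertices.
  Weights are affine in \<open>l\<close> and are unit vectors at the vertices, so on the edge only
  two can be nonzero.\<close>

lemma pauli_weight_edge:
  assumes "e edge_of pauli_tetrahedron" and "l \<in> e"
  obtains a b where "a < 4" "b < 4" "\<forall>k<4. pauli_weight l k \<ge> 0"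
    "\<forall>k<4. k \<noteq> a \<longrightarrow> k \<noteq> b \<longrightarrow> pauli_weight l k = 0"
proof -
  obtain c where c: "c \<subseteq> pauli_vertices" "e = convex hull c"
    using assms(1) face_of_convex_hull_affine_independent[OF pauli_vertices_affine_independent]
    by (auto simp: edge_of_def pauli_tetrahedron_def)
  have indep: "\<not> affine_dependent c"
    using c(1) affine_dependent_subset pauli_vertices_affine_independent by blast
  have "aff_dim c = 1"
    using assms(1) by (simp add: c(2) edge_of_def aff_dim_convex_hull)
  then have "card c = 2"
    using aff_dim_affine_independent[OF indep] by simp
  then obtain v w where vw: "c = {v, w}"
    by (meson card_2_iff)
  then obtain u where u: "0 \<le> u" "u \<le> 1" and l: "l = (1 - u) *\<^sub>R v + u *\<^sub>R w"
    using assms(2) by (auto simp: c(2) segment_convex_hull[symmetric] in_segment)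
  obtain a where a: "a < 4" "\<And>k. k < 4 \<Longrightarrow> pauli_weight v k = (if k = a then 1 else 0)"
    using pauli_weight_vertex c(1) vw by blast
  obtain b where b: "b < 4" "\<And>k. k < 4 \<Longrightarrow> pauli_weight w k = (if k = b then 1 else 0)"
    using pauli_weight_vertex c(1) vw by blast
  show ?thesis
    by (rule that[OF a(1) b(1)]) (use u a(2) b(2) in \<open>simp_all add: l pauli_weight_segment\<close>)
qed

section \<open>Separating two-point distributions by a Pauli sign pattern\<close>

lemma sum_pauli_weight: "(\<Sum>k<4. pauli_weight l k) = 1"
  by (simp add: sum_lessThan_4 pauli_weight_def field_simps)

text \<open>For \<open>j\<close> in {1, 2, 3} and \<open>k < 4\<close> this is 1 if
  \<open>pauli j\<close> and \<open>pauli k\<close> commute and -1 if they anticommute.\<close>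

definition pauli_sign :: "nat \<Rightarrow> nat \<Rightarrow> real" where
  "pauli_sign j k = (if k = 0 \<or> k = j then 1 else - 1)"

text \<open>The indices split into a pair with nonnegative and a pair with nonpositive entries,
  zeros filling up either one. The partner of index 0 selects the signed sum that adds all absolute
  values up to a global sign.\<close>

lemma sign_separation:
  fixes q0 q1 q2 q3 :: real
  assumes "q0 + q1 + q2 + q3 = 0"
    and "q0 \<le> 0 \<and> q1 \<le> 0 \<or> q0 \<le> 0 \<and> q2 \<le> 0 \<or> q0 \<le> 0 \<and> q3 \<le> 0
      \<or> q1 \<le> 0 \<and> q2 \<le> 0 \<or> q1 \<le> 0 \<and> q3 \<le> 0 \<or> q2 \<le> 0 \<and> q3 \<le> 0"
    and "q0 \<ge> 0 \<and> q1 \<ge> 0 \<or> q0 \<ge> 0 \<and> q2 \<ge> 0 \<or> q0 \<ge> 0 \<and> q3 \<ge> 0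
      \<or> q1 \<ge> 0 \<and> q2 \<ge> 0 \<or> q1 \<ge> 0 \<and> q3 \<ge> 0 \<or> q2 \<ge> 0 \<and> q3 \<ge> 0"
  shows "\<bar>q0\<bar> + \<bar>q1\<bar> + \<bar>q2\<bar> + \<bar>q3\<bar> \<le> \<bar>q0 + q1 - q2 - q3\<bar>
    \<or> \<bar>q0\<bar> + \<bar>q1\<bar> + \<bar>q2\<bar> + \<bar>q3\<bar> \<le> \<bar>q0 - q1 + q2 - q3\<bar>
    \<or> \<bar>q0\<bar> + \<bar>q1\<bar> + \<bar>q2\<bar> + \<bar>q3\<bar> \<le> \<bar>q0 - q1 - q2 + q3\<bar>"
  using assms by (smt (verit))

lemma two_point_support:
  fixes f :: "nat \<Rightarrow> real"
  assumes ab: "a < 4" "b < 4" and f: "\<forall>k<4. k \<noteq> a \<longrightarrow> k \<noteq> b \<longrightarrow> f k = 0"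
  shows "f 0 = 0 \<and> f 1 = 0 \<or> f 0 = 0 \<and> f 2 = 0 \<or> f 0 = 0 \<and> f 3 = 0
      \<or> f 1 = 0 \<and> f 2 = 0 \<or> f 1 = 0 \<and> f 3 = 0 \<or> f 2 = 0 \<and> f 3 = 0"
proof -
  have less_4: "k < 4 \<longleftrightarrow> k = 0 \<or> k = 1 \<or> k = 2 \<or> k = 3" for k :: nat
    by auto
  show ?thesis
    using ab f unfolding less_4 by (elim disjE) simp_all
qed

text \<open>The difference is at most 0 where \<open>p\<close> vanishes and at least 0 where
  \<open>p'\<close> vanishes. Each happens at two or more of the four indices.\<close>

lemma two_point_distributions_separated:
  fixes p p' :: "nat \<Rightarrow> real"
  assumes "a < 4" "b < 4" "a' < 4" "b' < 4"
    and p: "\<forall>k<4. p k \<ge> 0" "\<forall>k<4. k \<noteq> a \<longrightarrow> k \<noteq> b \<longrightarrow> p k = 0" "(\<Sum>k<4. p k) = 1"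
    and p': "\<forall>k<4. p' k \<ge> 0" "\<forall>k<4. k \<noteq> a' \<longrightarrow> k \<noteq> b' \<longrightarrow> p' k = 0" "(\<Sum>k<4. p' k) = 1"
  shows "\<exists>j\<in>{1, 2, 3}. (\<Sum>k<4. \<bar>p k - p' k\<bar>) \<le> \<bar>\<Sum>k<4. pauli_sign j k * (p k - p' k)\<bar>"
proof -
  define q where "q k = p k - p' k" for k
  have "p k \<ge> 0" "p' k \<ge> 0" if "k < 4" for k
    using p(1) p'(1) that by auto
  then have pos: "p 0 \<ge> 0" "p 1 \<ge> 0" "p 2 \<ge> 0" "p 3 \<ge> 0" "p' 0 \<ge> 0" "p' 1 \<ge> 0" "p' 2 \<ge> 0" "p' 3 \<ge> 0"
    by simp_all
  have "q 0 + q 1 + q 2 + q 3 = 0"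
    using p(3) p'(3) by (simp add: sum_lessThan_4 q_def)
  moreover have "q 0 \<le> 0 \<and> q 1 \<le> 0 \<or> q 0 \<le> 0 \<and> q 2 \<le> 0 \<or> q 0 \<le> 0 \<and> q 3 \<le> 0
      \<or> q 1 \<le> 0 \<and> q 2 \<le> 0 \<or> q 1 \<le> 0 \<and> q 3 \<le> 0 \<or> q 2 \<le> 0 \<and> q 3 \<le> 0"
    using two_point_support[OF assms(1,2) p(2)] pos unfolding q_def by (elim disjE) simp_all
  moreover have "q 0 \<ge> 0 \<and> q 1 \<ge> 0 \<or> q 0 \<ge> 0 \<and> q 2 \<ge> 0 \<or> q 0 \<ge> 0 \<and> q 3 \<ge> 0
      \<or> q 1 \<ge> 0 \<and> q 2 \<ge> 0 \<or> q 1 \<ge> 0 \<and> q 3 \<ge> 0 \<or> q 2 \<ge> 0 \<and> q 3 \<ge> 0"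
    using two_point_support[OF assms(3,4) p'(2)] pos unfolding q_def by (elim disjE) simp_all
  moreover have signed: "(\<Sum>k<4. pauli_sign 1 k * q k) = q 0 + q 1 - q 2 - q 3"
    "(\<Sum>k<4. pauli_sign 2 k * q k) = q 0 - q 1 + q 2 - q 3"
    "(\<Sum>k<4. pauli_sign 3 k * q k) = q 0 - q 1 - q 2 + q 3"
    by (simp_all add: sum_lessThan_4 pauli_sign_def)
  ultimately show ?thesis
    using sign_separation[of "q 0" "q 1" "q 2" "q 3"]
    unfolding q_def[symmetric] signed sum_lessThan_4[of "\<lambda>k. \<bar>q k\<bar>"] by (simp add: signed[simplified])
qed

text \<open>\<open>pauli_eigenvector j\<close> spans the \<open>+1\<close>-eigenspace of \<open>pauli j\<close>.\<close>

definition pauli_eigenvector :: "nat \<Rightarrow> complex^2" where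
  "pauli_eigenvector j = (if j = 1 then vector [1 / sqrt 2, 1 / sqrt 2]
     else if j = 2 then vector [1 / sqrt 2, \<i> / sqrt 2] else vector [1, 0])"

lemma norm_pauli_eigenvector: "norm (pauli_eigenvector j) = 1"
  by (simp add: pauli_eigenvector_def norm_vec_def L2_set_def sum_2 norm_divide power_divide)

text \<open>With v the eigenvector, \<open>pauli k *v v\<close> is again an eigenvector of
  \<open>pauli j\<close>, with eigenvalue \<open>pauli_sign j k\<close>. The trace is the
  expectation of \<open>pauli j\<close> in it.\<close>

lemma trace_pauli_eigenvector:
  assumes "j \<in> {1, 2, 3}" and "k < 4"
  shows "trace (pauli j ** (pauli k ** outer (pauli_eigenvector j) ** cadjoint (pauli k)))
      = pauli_sign j k"
proof -
  have s: "complex_of_real (sqrt 2) * complex_of_real (sqrt 2) = 2"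
    by (simp flip: of_real_mult)
  have "k = 0 \<or> k = 1 \<or> k = 2 \<or> k = 3"
    using assms(2) by auto
  then show ?thesis
    using assms(1)
    by (auto simp: trace_def matrix_matrix_mult_def sum_2 pauli_nth outer_def pauli_eigenvector_def
        pauli_sign_def s)
qed

section \<open>Discrimination of two quasi-extreme channels\<close>

lemma quasi_extreme_weights:
  assumes "\<Phi> \<in> quasi_extreme"
  obtains l a b where "qubit_channel \<Phi>" "bloch_action \<Phi> (diag l) 0" "a < 4" "b < 4"
    "\<forall>k<4. pauli_weight l k \<ge> 0" "\<forall>k<4. k \<noteq> a \<longrightarrow> k \<noteq> b \<longrightarrow> pauli_weight l k = 0"
proof -
  obtain l e where l: "qubit_channel \<Phi>" "bloch_action \<Phi> (diag l) 0" "e edge_of pauli_tetrahedron" "l \<in> e"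
    using assms by (auto simp: quasi_extreme_def diagonal_channels_def)
  obtain a b where "a < 4" "b < 4" "\<forall>k<4. pauli_weight l k \<ge> 0"
    "\<forall>k<4. k \<noteq> a \<longrightarrow> k \<noteq> b \<longrightarrow> pauli_weight l k = 0"
    using l(3,4) by (rule pauli_weight_edge)
  then show ?thesis
    by (rule that[OF l(1,2)])
qed

theorem mainTheorem1:
  fixes N1 N2 :: "complex^2^2 \<Rightarrow> complex^2^2"
  assumes "N1 \<in> quasi_extreme" and "N2 \<in> quasi_extreme"
  shows "(SUP \<Psi>\<in>(pure_states :: (complex^(2 \<times> 2)^(2 \<times> 2)) set).
            trace_norm (id_tensor N1 \<Psi> - id_tensor N2 \<Psi>))
       = (SUP \<psi>\<in>(pure_states :: (complex^2^2) set). trace_norm (N1 \<psi> - N2 \<psi>))"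
proof -
  let ?ent = "\<lambda>\<Psi> :: complex^(2 \<times> 2)^(2 \<times> 2). trace_norm (id_tensor N1 \<Psi> - id_tensor N2 \<Psi>)"
  let ?loc = "\<lambda>\<psi>. trace_norm (N1 \<psi> - N2 \<psi>)"
  obtain l1 a1 b1 where l1: "qubit_channel N1" "bloch_action N1 (diag l1) 0" "a1 < 4" "b1 < 4"
    "\<forall>k<4. pauli_weight l1 k \<ge> 0" "\<forall>k<4. k \<noteq> a1 \<longrightarrow> k \<noteq> b1 \<longrightarrow> pauli_weight l1 k = 0"
    using assms(1) by (rule quasi_extreme_weights)
  obtain l2 a2 b2 where l2: "qubit_channel N2" "bloch_action N2 (diag l2) 0" "a2 < 4" "b2 < 4"
    "\<forall>k<4. pauli_weight l2 k \<ge> 0" "\<forall>k<4. k \<noteq> a2 \<longrightarrow> k \<noteq> b2 \<longrightarrow> pauli_weight l2 k = 0"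
    using assms(2) by (rule quasi_extreme_weights)
  have lin: "Vector_Spaces.linear cscale cscale N1" "Vector_Spaces.linear cscale cscale N2"
    using l1(1) l2(1) by (simp_all add: qubit_channel_def)
  define q where "q k = pauli_weight l1 k - pauli_weight l2 k" for k
  \<comment> \<open>Both suprema will turn out to be attained and equal to \<open>M\<close>.\<close>
  define M where "M = (\<Sum>k<4. \<bar>q k\<bar>)"
  have diff: "N1 A - N2 A = (\<Sum>k<4. q k *\<^sub>R (pauli k ** A ** cadjoint (pauli k)))" for A
    by (simp add: q_def channel_eq_pauli_mixture[OF lin(1) l1(2)] channel_eq_pauli_mixture[OF lin(2) l2(2)]
        scaleR_diff_left sum_subtractf)

  have upper: "?ent \<Psi> \<le> M" if \<Psi>: "\<Psi> \<in> pure_states" for \<Psi> :: "complex^(2 \<times> 2)^(2 \<times> 2)"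
  proof -
    obtain w where w: "norm w = 1" "\<Psi> = outer w"
      using \<Psi> by (rule pure_state_outer)
    have "id_tensor N1 \<Psi> - id_tensor N2 \<Psi> = id_tensor (\<lambda>A. N1 A - N2 A) \<Psi>"
      by (simp add: id_tensor_def vec_eq_iff)
    also have "\<dots> = (\<Sum>k<4. q k *\<^sub>R id_tensor (\<lambda>A. pauli k ** A ** cadjoint (pauli k)) \<Psi>)"
      by (simp add: diff id_tensor_def vec_eq_iff)
    also have "\<dots> = (\<Sum>k<4. q k *\<^sub>R outer (kron (mat 1) (pauli k) *v w))"
      by (simp add: w(2) id_tensor_conjugate_outer)
    finally show ?thesis
      unfolding M_def
      by (simp add: trace_norm_sum_outer_le norm_unitary unitary_kron unitary_mat_1 unitary_pauli w(1))
  qed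

  have embed: "\<exists>\<Psi>\<in>pure_states. ?loc \<psi> \<le> ?ent \<Psi>" if \<psi>: "\<psi> \<in> pure_states" for \<psi>
  proof -
    obtain w where w: "norm w = 1" "\<psi> = outer w"
      using \<psi> by (rule pure_state_outer)
    define v :: "complex^2" where "v = axis 1 1"
    have v: "norm v = 1"
      by (simp add: v_def)
    have "id_tensor N1 (kron (outer v) \<psi>) - id_tensor N2 (kron (outer v) \<psi>)
        = kron (outer v) (N1 \<psi>) - kron (outer v) (N2 \<psi>)"
      by (simp add: id_tensor_kron lin)
    also have "\<dots> = kron (outer v) (N1 \<psi> - N2 \<psi>)"
      by (simp add: kron_def vec_eq_iff right_diff_distrib)
    finally have "?loc \<psi> \<le> ?ent (kron (outer v) \<psi>)"
      using trace_norm_kron_outer_ge[OF v] by simp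
    moreover have "kron (outer v) \<psi> \<in> pure_states"
      unfolding w(2) kron_outer by (intro outer_pure_state norm_tensor_vector v w(1))
    ultimately show ?thesis
      by blast
  qed

  obtain j where j: "j \<in> {1, 2, 3}" "M \<le> \<bar>\<Sum>k<4. pauli_sign j k * q k\<bar>"
    using two_point_distributions_separated[OF l1(3,4) l2(3,4) l1(5,6) sum_pauli_weight l2(5,6) sum_pauli_weight]
    unfolding q_def M_def by blast
  define \<psi> where "\<psi> = outer (pauli_eigenvector j)"
  have \<psi>: "\<psi> \<in> pure_states"
    unfolding \<psi>_def by (intro outer_pure_state norm_pauli_eigenvector)
  have attained: "M \<le> ?loc \<psi>"
  proof -
    have "trace (pauli j ** (N1 \<psi> - N2 \<psi>)) = (\<Sum>k<4. q k *\<^sub>R complex_of_real (pauli_sign j k))"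
      by (simp add: diff matrix_mult_sum_right trace_sum matrix_mult_scaleR_right trace_scaleR \<psi>_def
          trace_pauli_eigenvector[OF j(1)])
    then have re: "Re (trace (pauli j ** (N1 \<psi> - N2 \<psi>))) = (\<Sum>k<4. pauli_sign j k * q k)"
      by (simp add: mult.commute)
    \<comment> \<open>The sign of the signed sum is unknown, so both \<open>pauli j\<close> and
      \<open>- pauli j\<close> serve as test unitaries to bound its absolute value.\<close>
    have "trace (- pauli j ** (N1 \<psi> - N2 \<psi>)) = - trace (pauli j ** (N1 \<psi> - N2 \<psi>))"
      by (simp add: trace_def matrix_matrix_mult_def sum_negf)
    moreover have "unitary (- pauli j)"
      using unitary_pauli[of j] by (simp add: unitary_def matrix_matrix_mult_def vec_eq_iff)
    ultimately have "- Re (trace (pauli j ** (N1 \<psi> - N2 \<psi>))) \<le> ?loc \<psi>"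
      using trace_norm_ge[of "- pauli j" "N1 \<psi> - N2 \<psi>"] by simp
    then have "\<bar>Re (trace (pauli j ** (N1 \<psi> - N2 \<psi>)))\<bar> \<le> ?loc \<psi>"
      using trace_norm_ge[OF unitary_pauli[of j], of "N1 \<psi> - N2 \<psi>"] by (simp add: abs_le_iff)
    then show ?thesis
      using j(2) re by simp
  qed

  \<comment> \<open>A local input is dominated by a product input, so the bound for bipartite states
    carries over.\<close>
  have local_upper: "?loc \<phi> \<le> M" if "\<phi> \<in> pure_states" for \<phi>
    using embed[OF that] upper order_trans by blast
  \<comment> \<open>Over the reals \<open>SUP\<close> is meaningful only for a nonempty bounded
    family; exhibiting \<open>M\<close> as an attained maximum settles both conditions.\<close>
  have "(SUP \<psi>\<in>pure_states. ?loc \<psi>) = M"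
  proof (rule cSup_eq_maximum)
    show "M \<in> ?loc ` pure_states"
      by (rule image_eqI[of _ ?loc, OF antisym[OF attained local_upper[OF \<psi>]] \<psi>])
  qed (auto intro: local_upper)
  moreover obtain \<Psi> where \<Psi>: "\<Psi> \<in> pure_states" "M \<le> ?ent \<Psi>"
    using embed[OF \<psi>] attained order_trans by blast
  have "(SUP \<Psi>\<in>pure_states. ?ent \<Psi>) = M"
  proof (rule cSup_eq_maximum)
    show "M \<in> ?ent ` pure_states"
      by (rule image_eqI[of _ ?ent, OF antisym[OF \<Psi>(2) upper[OF \<Psi>(1)]] \<Psi>(1)])
  qed (auto intro: upper)
  ultimately show ?thesis
    by simp
qed

end
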